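(* In the semiring $\mathbb N$, for every $n\geqslant2$ one has $(n\mathbb N)^g=\mathrm{rad}(n)\mathbb N$, where $\mathrm{rad}(n)$ is the product of the distinct prime divisors of $n$. Moreover $\{0\}^g=\{0\}$, while $(\mathbb N\setminus\{1\})^g=\mathbb N$.
   Context: $\mathbb N=\{0,1,2,\dots\}$ is the commutative semiring of natural numbers with usual $+$ and $\cdot$. An ideal of a commutative semiring $S$ is a non-empty subset closed under addition and under multiplication by arbitrary elements of $S$. A congruence on $S$ is an equivalence relation compatible with $+$ and $\cdot$; it is proper if $\neq S\times S$, and maximal congruences are maximal among proper congruences. The zero-class of $\theta$ is $0_\theta=\{a\in S\mid(a,0)\in\theta\}$. For an ideal $I$, $\wp_I$ is the intersection of all maximal congruences $\theta$ with $I\subseteq 0_\theta$ (equal to $S\times S$ if there are none), and the canonical $g$-closure of $I$ is $I^g=0_{\wp_I}$. *)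

theory Defs
  imports "HOL-Computational_Algebra.Computational_Algebra"
begin

definition semiring_ideal :: "'a::comm_semiring_1 set \<Rightarrow> bool" where
  "semiring_ideal I \<longleftrightarrow>
     I \<noteq> {} \<and> (\<forall>a\<in>I. \<forall>b\<in>I. a + b \<in> I) \<and> (\<forall>a\<in>I. \<forall>s. s * a \<in> I)"

definition semiring_congruence :: "('a::comm_semiring_1 \<times> 'a) set \<Rightarrow> bool" where
  "semiring_congruence \<theta> \<longleftrightarrow>
     equiv UNIV \<theta> \<and>
     (\<forall>a b c d. (a, b) \<in> \<theta> \<longrightarrow> (c, d) \<in> \<theta> \<longrightarrow>
        (a + c, b + d) \<in> \<theta> \<and> (a * c, b * d) \<in> \<theta>)"

definition proper_congruence :: "('a::comm_semiring_1 \<times> 'a) set \<Rightarrow> bool" where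
  "proper_congruence \<theta> \<longleftrightarrow> semiring_congruence \<theta> \<and> \<theta> \<noteq> UNIV \<times> UNIV"

definition maximal_congruence :: "('a::comm_semiring_1 \<times> 'a) set \<Rightarrow> bool" where
  "maximal_congruence \<theta> \<longleftrightarrow>
     proper_congruence \<theta> \<and> (\<forall>\<sigma>. proper_congruence \<sigma> \<longrightarrow> \<theta> \<subseteq> \<sigma> \<longrightarrow> \<sigma> = \<theta>)"

definition zero_class :: "('a::comm_semiring_1 \<times> 'a) set \<Rightarrow> 'a set" where
  "zero_class \<theta> = {a. (a, 0) \<in> \<theta>}"

text \<open>If no maximal congruence qualifies, the intersection of the empty family is the
  universal relation, as required.\<close>

definition wp :: "'a::comm_semiring_1 set \<Rightarrow> ('a \<times> 'a) set" where
  "wp I = \<Inter> {\<theta>. maximal_congruence \<theta> \<and> I \<subseteq> zero_class \<theta>}"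

text \<open>The closure is intended for ideals only; the definition makes sense for any subset.
  The lemmas below show that the sets it is applied to are ideals.\<close>

definition g_closure :: "'a::comm_semiring_1 set \<Rightarrow> 'a set" where
  "g_closure I = zero_class (wp I)"

definition rad :: "nat \<Rightarrow> nat" where
  "rad n = \<Prod>(prime_factors n)"

lemma semiring_ideal_multiples: "semiring_ideal {n * k | k. True}"
  for n :: "'a::comm_semiring_1"
  unfolding semiring_ideal_def
proof (intro conjI ballI allI)
  show "{n * k | k. True} \<noteq> {}" by blast
next
  fix a b assume "a \<in> {n * k | k. True}" "b \<in> {n * k | k. True}"
  then obtain i j where "a = n * i" "b = n * j" by blast
  then have "a + b = n * (i + j)" by (simp add: distrib_left)
  then show "a + b \<in> {n * k | k. True}" by blast
next
  fix a s assume "a \<in> {n * k | k. True}"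
  then obtain i where "a = n * i" by blast
  then have "s * a = n * (s * i)" by (simp add: mult.left_commute)
  then show "s * a \<in> {n * k | k. True}" by blast
qed

lemma semiring_ideal_zero: "semiring_ideal {0 :: 'a::comm_semiring_1}"
  by (simp add: semiring_ideal_def)

lemma semiring_ideal_nat_minus_one: "semiring_ideal (UNIV - {1 :: nat})"
  unfolding semiring_ideal_def by (auto simp: add_is_1)

end

theory Submission
  imports Defs
begin

text \<open>The proof rests on two kinds of maximal congruences on the natural numbers: congruence
  modulo a prime \<open>p\<close>, and the one identifying all positive numbers. Conversely, if \<open>\<theta>\<close> is a proper
  congruence relating a positive number to \<open>0\<close>, and \<open>d\<close> is the least such number, then \<open>\<theta>\<close> is
  congruence modulo \<open>d\<close>; a maximal such \<open>\<theta>\<close> is therefore congruence modulo a prime. Hence the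
  maximal congruences whose zero-class contains a positive \<open>n\<close> are those modulo the prime divisors
  of \<open>n\<close>. The all-positive congruence gives the closure of \<open>{0}\<close>, and for the last ideal one has
  \<open>1 \<sim> 1 + 2 \<sim> 0\<close>.\<close>

section \<open>Generalities on semiring congruences\<close>

lemma congruence_add:
  "semiring_congruence \<theta> \<Longrightarrow> (a, b) \<in> \<theta> \<Longrightarrow> (c, d) \<in> \<theta> \<Longrightarrow> (a + c, b + d) \<in> \<theta>"
  by (simp add: semiring_congruence_def)

lemma congruence_mult:
  "semiring_congruence \<theta> \<Longrightarrow> (a, b) \<in> \<theta> \<Longrightarrow> (c, d) \<in> \<theta> \<Longrightarrow> (a * c, b * d) \<in> \<theta>"
  by (simp add: semiring_congruence_def)

lemma congruence_refl: "semiring_congruence \<theta> \<Longrightarrow> (a, a) \<in> \<theta>"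
  by (auto simp: semiring_congruence_def equiv_def refl_on_def)

lemma congruence_sym: "semiring_congruence \<theta> \<Longrightarrow> (a, b) \<in> \<theta> \<Longrightarrow> (b, a) \<in> \<theta>"
  by (auto simp: semiring_congruence_def equiv_def dest: symD)

lemma congruence_trans:
  "semiring_congruence \<theta> \<Longrightarrow> (a, b) \<in> \<theta> \<Longrightarrow> (b, c) \<in> \<theta> \<Longrightarrow> (a, c) \<in> \<theta>"
  unfolding semiring_congruence_def equiv_def by (meson transD)

text \<open>Multiplying \<open>1 \<sim> 0\<close> by any \<open>a\<close> gives
  \<open>a \<sim> 0\<close>, so every element collapses to \<open>0\<close>.\<close>

lemma congruence_eq_UNIV_if_one_zero:
  assumes "semiring_congruence \<theta>" and "(1, 0) \<in> \<theta>"
  shows "\<theta> = UNIV"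
proof -
  have zero: "(a, 0) \<in> \<theta>" for a
    using congruence_mult[OF assms(1) congruence_refl[OF assms(1), of a] assms(2)] by simp
  have "(a, b) \<in> \<theta>" for a b
    using congruence_trans[OF assms(1) zero congruence_sym[OF assms(1) zero]] .
  then show ?thesis by auto
qed

lemma congruence_zero_mult:
  assumes "semiring_congruence \<theta>" and "(a, 0) \<in> \<theta>"
  shows "(a * c, 0) \<in> \<theta>"
  using congruence_mult[OF assms congruence_refl[OF assms(1), of c]] by simp

lemma congruence_add_zero:
  assumes "semiring_congruence \<theta>" and "(c, 0) \<in> \<theta>"
  shows "(a + c, a) \<in> \<theta>"
  using congruence_add[OF assms(1) congruence_refl[OF assms(1), of a] assms(2)] by simp

section \<open>Congruences modulo \<open>m\<close> and the all-positive congruence\<close>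

definition mod_congruence :: "nat \<Rightarrow> (nat \<times> nat) set" where
  "mod_congruence m = {(a, b). a mod m = b mod m}"

text \<open>The kernel of the homomorphism from the naturals onto the Boolean semiring.\<close>

definition positive_congruence :: "(nat \<times> nat) set" where
  "positive_congruence = {(a, b). a = 0 \<longleftrightarrow> b = 0}"

lemma semiring_congruence_mod: "semiring_congruence (mod_congruence m)"
proof -
  have "equiv UNIV (mod_congruence m)"
    by (rule equivI) (auto simp: mod_congruence_def refl_on_def sym_def trans_def)
  moreover have "(a + c, b + d) \<in> mod_congruence m \<and> (a * c, b * d) \<in> mod_congruence m"
    if "(a, b) \<in> mod_congruence m" "(c, d) \<in> mod_congruence m" for a b c d
    using that mod_add_cong[of a m b c d] mod_mult_cong[of a m b c d]
    by (simp only: mod_congruence_def mem_Collect_eq case_prod_conv simp_thms)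
  ultimately show ?thesis
    unfolding semiring_congruence_def by blast
qed

lemma proper_congruence_mod:
  assumes "m \<noteq> 1"
  shows "proper_congruence (mod_congruence m)"
proof -
  have "(1, 0) \<notin> mod_congruence m"
    using assms by (simp add: mod_congruence_def)
  then show ?thesis
    using semiring_congruence_mod by (auto simp: proper_congruence_def)
qed

section \<open>Congruences relating a positive number to \<open>0\<close>\<close>

text \<open>Once a positive \<open>n\<close> is related to \<open>0\<close>, the quotient by
  \<open>\<theta>\<close> is a ring, so summands can be cancelled there.\<close>

lemma congruence_cancel_le:
  fixes a b n :: nat
  assumes "semiring_congruence \<theta>" and "(n, 0) \<in> \<theta>" and "n > 0"
    and "(a, b) \<in> \<theta>" and "b \<le> a"
  shows "(a - b, 0) \<in> \<theta>"
proof -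
  \<comment> \<open>\<open>n * b - b\<close> plays the role of \<open>- b\<close>.\<close>
  have "b \<le> n * b" using assms(3) by simp
  then have e: "a + (n * b - b) = (a - b) + n * b" "b + (n * b - b) = n * b"
    using assms(5) by auto
  have z: "(n * b, 0) \<in> \<theta>" using congruence_zero_mult[OF assms(1,2)] .
  have "(a - b + n * b, n * b) \<in> \<theta>"
    using congruence_add[OF assms(1,4) congruence_refl[OF assms(1)], of "n * b - b"]
    by (simp only: e)
  then show ?thesis
    using congruence_add_zero[OF assms(1) z] z congruence_sym congruence_trans assms(1) by meson
qed

text \<open>Minimality of \<open>d\<close> leaves no positive remainder modulo \<open>d\<close> in
  the zero-class, and cancellation reduces arbitrary pairs to the zero-class. The value
  \<open>d = 1\<close> is the universal congruence.\<close>

lemma congruence_eq_mod: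
  fixes \<theta> :: "(nat \<times> nat) set"
  assumes cong: "semiring_congruence \<theta>" and "(n, 0) \<in> \<theta>" and "n > 0"
  obtains d where "d > 0" and "\<theta> = mod_congruence d"
proof -
  define d where "d = (LEAST d. d > 0 \<and> (d, 0) \<in> \<theta>)"
  have d: "d > 0" "(d, 0) \<in> \<theta>"
    using LeastI[of "\<lambda>d. d > 0 \<and> (d, 0) \<in> \<theta>" n] assms unfolding d_def by auto
  have least: "d \<le> e" if "e > 0" "(e, 0) \<in> \<theta>" for e
    unfolding d_def by (rule Least_le) (use that in auto)
  \<comment> \<open>Here \<open>a = a mod d + d * (a div d)\<close>, and the second summand is
    related to \<open>0\<close>.\<close>
  have red: "(a, a mod d) \<in> \<theta>" for a
    using congruence_add_zero[OF cong congruence_zero_mult[OF cong d(2)], of "a mod d" "a div d"]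
    by simp
  have zero: "d dvd a" if "(a, 0) \<in> \<theta>" for a
  proof -
    have "(a mod d, 0) \<in> \<theta>"
      using red that cong congruence_sym congruence_trans by meson
    then show ?thesis
      using least[of "a mod d"] d(1) mod_less_divisor[OF d(1), of a]
      by (auto simp: dvd_eq_mod_eq_0)
  qed
  have le: "a mod d = b mod d" if "(a, b) \<in> \<theta>" "b \<le> a" for a b
    using zero[OF congruence_cancel_le[OF cong d(2,1) that]] that(2)
    by (simp add: mod_eq_dvd_iff_nat)
  have "(a, b) \<in> \<theta> \<longleftrightarrow> a mod d = b mod d" for a b
  proof
    assume "(a, b) \<in> \<theta>"
    then show "a mod d = b mod d"
      using le[of a b] le[of b a] congruence_sym[OF cong] by (cases "b \<le> a") auto
  next
    assume "a mod d = b mod d"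
    then show "(a, b) \<in> \<theta>"
      using red[of a] red[of b] congruence_sym[OF cong] congruence_trans[OF cong] by metis
  qed
  then have "\<theta> = mod_congruence d"
    by (auto simp: mod_congruence_def)
  with d(1) that show thesis by blast
qed

text \<open>For a prime \<open>p\<close> dividing \<open>d\<close>, congruence modulo
  \<open>p\<close> is proper and contains congruence modulo \<open>d\<close>, so maximality makes
  them equal.\<close>

lemma maximal_congruence_eq_mod_prime:
  fixes \<theta> :: "(nat \<times> nat) set"
  assumes "maximal_congruence \<theta>" and "(n, 0) \<in> \<theta>" and "n > 0"
  obtains p where "prime p" and "\<theta> = mod_congruence p"
proof -
  have proper: "semiring_congruence \<theta>" "\<theta> \<noteq> UNIV"
    using assms(1) by (auto simp: maximal_congruence_def proper_congruence_def)
  obtain d where d: "\<theta> = mod_congruence d"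
    using congruence_eq_mod[OF proper(1) assms(2,3)] .
  have "d \<noteq> 1"
    using proper(2) d by (auto simp: mod_congruence_def)
  then obtain p where p: "prime p" "p dvd d"
    using prime_factor_nat by blast
  have "\<theta> \<subseteq> mod_congruence p"
    using mod_mod_cancel[OF p(2)] unfolding d mod_congruence_def by (auto, metis)
  moreover have "proper_congruence (mod_congruence p)"
    using p(1) by (intro proper_congruence_mod) auto
  ultimately have "mod_congruence p = \<theta>"
    using assms(1) by (auto simp: maximal_congruence_def)
  with p(1) that show thesis by blast
qed

text \<open>A proper \<open>\<sigma>\<close> above it relates \<open>p\<close> to \<open>0\<close>,
  hence is congruence modulo some \<open>d\<close>. Then \<open>d\<close> divides \<open>p\<close>,
  and properness excludes \<open>d = 1\<close>.\<close>

lemma maximal_congruence_mod_prime: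
  assumes "prime p"
  shows "maximal_congruence (mod_congruence p)"
  unfolding maximal_congruence_def
proof (intro conjI allI impI)
  show "proper_congruence (mod_congruence p)"
    using assms by (intro proper_congruence_mod) auto
next
  fix \<sigma> assume \<sigma>: "proper_congruence \<sigma>" and sub: "mod_congruence p \<subseteq> \<sigma>"
  have p: "(p, 0) \<in> \<sigma>" "p > 0"
    using sub assms by (auto simp: mod_congruence_def prime_gt_0_nat)
  obtain d where d: "\<sigma> = mod_congruence d"
    using congruence_eq_mod p \<sigma> unfolding proper_congruence_def by metis
  have "d \<noteq> 1"
    using \<sigma> d by (auto simp: proper_congruence_def mod_congruence_def)
  moreover have "d dvd p"
    using p(1) d by (auto simp: mod_congruence_def)
  ultimately have "d = p"
    using assms by (auto simp: prime_nat_iff)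
  with d show "\<sigma> = mod_congruence p" by simp
qed

text \<open>If a larger congruence relates a positive \<open>a\<close> to \<open>0\<close>, it
  relates \<open>1\<close> to \<open>0\<close> as well, because \<open>1\<close> and
  \<open>a\<close> are already identified; it is then universal.\<close>

lemma maximal_congruence_positive: "maximal_congruence positive_congruence"
  unfolding maximal_congruence_def
proof (intro conjI allI impI)
  have "semiring_congruence positive_congruence"
    unfolding semiring_congruence_def positive_congruence_def
    by (auto intro!: equivI refl_onI symI transI)
  moreover have "(1, 0) \<notin> positive_congruence"
    by (simp add: positive_congruence_def)
  ultimately show "proper_congruence positive_congruence"
    by (auto simp: proper_congruence_def)
next
  fix \<sigma> assume \<sigma>: "proper_congruence \<sigma>" and sub: "positive_congruence \<subseteq> \<sigma>"
  have cong: "semiring_congruence \<sigma>" and "\<sigma> \<noteq> UNIV"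
    using \<sigma> by (auto simp: proper_congruence_def)
  then have one: "(1, 0) \<notin> \<sigma>"
    using congruence_eq_UNIV_if_one_zero by blast
  have "(a, 0) \<notin> \<sigma>" if "a > 0" for a
  proof -
    have "(1, a) \<in> \<sigma>"
      by (rule subsetD[OF sub]) (use that in \<open>simp add: positive_congruence_def\<close>)
    then show ?thesis
      using one congruence_trans[OF cong] by blast
  qed
  then have "a = 0 \<longleftrightarrow> b = 0" if "(a, b) \<in> \<sigma>" for a b
    using that congruence_sym[OF cong that] by (metis gr0I)
  then have "\<sigma> \<subseteq> positive_congruence"
    by (auto simp: positive_congruence_def)
  with sub show "\<sigma> = positive_congruence" by blast
qed

section \<open>Computation of the closures\<close>

lemma mem_g_closure_iff:
  "x \<in> g_closure I \<longleftrightarrow> (\<forall>\<theta>. maximal_congruence \<theta> \<longrightarrow> I \<subseteq> zero_class \<theta> \<longrightarrow> (x, 0) \<in> \<theta>)"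
  by (auto simp: g_closure_def wp_def zero_class_def)

text \<open>Distinct primes are coprime, so their product divides \<open>x\<close> once each of them
  does.\<close>

lemma rad_dvd_iff:
  assumes "n > 0"
  shows "rad n dvd x \<longleftrightarrow> (\<forall>p. prime p \<longrightarrow> p dvd n \<longrightarrow> p dvd x)"
proof
  assume "rad n dvd x"
  moreover have "p dvd rad n" if "prime p" "p dvd n" for p
    using dvd_prodI[of "prime_factors n" p "\<lambda>p. p"] that assms
    by (simp add: rad_def in_prime_factors_iff)
  ultimately show "\<forall>p. prime p \<longrightarrow> p dvd n \<longrightarrow> p dvd x"
    using dvd_trans by blast
next
  assume *: "\<forall>p. prime p \<longrightarrow> p dvd n \<longrightarrow> p dvd x"
  \<comment> \<open>Passing to subsets \<open>A\<close> of the prime factors lets the primes be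
    adjoined one at a time.\<close>
  have "\<Prod>A dvd x" if "finite A" "A \<subseteq> prime_factors n" for A
    using that
  proof (induction A rule: finite_induct)
    case (insert p A)
    have "coprime p q" if "q \<in> A" for q
      using insert.hyps(2) insert.prems that
      by (intro primes_coprime) (auto simp: in_prime_factors_iff)
    then have "coprime p (\<Prod>A)"
      by (rule prod_coprime_right)
    moreover have "p dvd x"
      using * insert.prems by (auto simp: in_prime_factors_iff)
    ultimately show ?case
      using insert by (simp add: divides_mult)
  qed simp
  then show "rad n dvd x"
    by (simp add: rad_def)
qed

text \<open>Membership on either side amounts to divisibility by every prime divisor of
  \<open>n\<close>. For \<open>n = 1\<close> this condition is empty and both sides are all of the
  naturals.\<close>

lemma g_closure_multiples:
  fixes n :: nat
  assumes "n > 0"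
  shows "g_closure {n * k | k. True} = {rad n * k | k. True}"
proof -
  have "x \<in> g_closure {n * k | k. True} \<longleftrightarrow> (\<forall>p. prime p \<longrightarrow> p dvd n \<longrightarrow> p dvd x)" for x
    unfolding mem_g_closure_iff
  proof (intro iffI allI impI)
    fix p assume *: "\<forall>\<theta>. maximal_congruence \<theta> \<longrightarrow> {n * k | k. True} \<subseteq> zero_class \<theta> \<longrightarrow> (x, 0) \<in> \<theta>"
      and p: "prime p" "p dvd n"
    have "{n * k | k. True} \<subseteq> zero_class (mod_congruence p)"
      using p(2) by (auto simp: zero_class_def mod_congruence_def)
    then show "p dvd x"
      using * maximal_congruence_mod_prime[OF p(1)] by (auto simp: mod_congruence_def)
  next
    fix \<theta> assume *: "\<forall>p. prime p \<longrightarrow> p dvd n \<longrightarrow> p dvd x"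
      and \<theta>: "maximal_congruence \<theta>" "{n * k | k. True} \<subseteq> zero_class \<theta>"
    have n: "(n, 0) \<in> \<theta>"
      using \<theta>(2) by (auto simp: zero_class_def dest!: subsetD[where c = "n * 1"])
    obtain p where "prime p" and p: "\<theta> = mod_congruence p"
      using maximal_congruence_eq_mod_prime[OF \<theta>(1) n assms] .
    \<comment> \<open>That \<open>n\<close> is related to \<open>0\<close> modulo \<open>p\<close>
      says that \<open>p\<close> divides \<open>n\<close>, so \<open>p\<close> divides
      \<open>x\<close> by assumption.\<close>
    then show "(x, 0) \<in> \<theta>"
      using * n by (auto simp: mod_congruence_def)
  qed
  then show ?thesis
    using rad_dvd_iff[OF assms] by (auto simp: dvd_def)
qed

text \<open>A single qualifying congruence with zero-class \<open>{0}\<close> already cuts the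
  closure down to \<open>{0}\<close>.\<close>

lemma g_closure_zero: "g_closure {0 :: nat} = {0}"
proof -
  have "{0} \<subseteq> zero_class positive_congruence"
    by (simp add: zero_class_def positive_congruence_def)
  then have "x = 0" if "x \<in> g_closure {0}" for x :: nat
    using that maximal_congruence_positive
    by (auto simp: mem_g_closure_iff positive_congruence_def)
  moreover have "0 \<in> g_closure {0 :: nat}"
    by (auto simp: mem_g_closure_iff zero_class_def)
  ultimately show ?thesis by blast
qed

text \<open>Both \<open>2\<close> and \<open>3\<close> lie in the ideal, which forces
  \<open>1\<close> into the zero-class. So in fact no maximal congruence qualifies and the
  intersection is over the empty family.\<close>

lemma g_closure_nat_minus_one: "g_closure (UNIV - {1 :: nat}) = UNIV"
proof -
  have "(x, 0) \<in> \<theta>" if "maximal_congruence \<theta>" and sub: "UNIV - {1} \<subseteq> zero_class \<theta>"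
    for \<theta> and x :: nat
  proof -
    have cong: "semiring_congruence \<theta>"
      using that(1) by (simp add: maximal_congruence_def proper_congruence_def)
    have zero: "(y, 0) \<in> \<theta>" if "y \<noteq> 1" for y
      using sub that by (auto simp: zero_class_def)
    have "(1 + 2, 1) \<in> \<theta>"
      by (rule congruence_add_zero[OF cong zero]) simp
    moreover have "(1 + 2, 0) \<in> \<theta>"
      by (rule zero) simp
    ultimately have "(1, 0) \<in> \<theta>"
      using congruence_sym[OF cong] congruence_trans[OF cong] by blast
    with zero show ?thesis by (cases "x = 1") auto
  qed
  then show ?thesis by (auto simp: mem_g_closure_iff)
qed

theorem proposition9p2:
  shows "(\<forall>n::nat. n \<ge> 2 \<longrightarrow> g_closure {n * k | k. True} = {rad n * k | k. True})
    \<and> g_closure {0::nat} = {0}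
    \<and> g_closure (UNIV - {1::nat}) = UNIV"
  using g_closure_multiples g_closure_zero g_closure_nat_minus_one by simp

end
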